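(* Let $f:\mathbb{C}^n\to\mathbb{C}^m$ be a generically finite polynomial map of degree $d$. Then the set $S_f$ of points of $\mathbb{C}^m$ at which $f$ is not proper is covered by polynomially parametric curves of degree at most $d-1$; that is, for every $y\in S_f$ there exists a non-constant polynomial map $l:\mathbb{C}\to\mathbb{C}^m$ of degree at most $d-1$ with $l(\mathbb{C})\subset S_f$ and $y\in l(\mathbb{C})$.
   Context: The degree of a polynomial map $f=(f_1,\dots,f_m)$ is $\max_i\deg f_i$. The map $f:X\to Y$ between complex affine varieties is generically finite if its general fibers (over its image) are finite, so that infinite fibers cover only a nowhere dense subset of the source. A polynomial map $f:X\to Y$ between complex affine varieties is proper at a point $y\in Y$ if there exists an open neighborhood $U$ of $y$ such that $f|_{f^{-1}(U)}:f^{-1}(U)\to U$ is a proper map; $S_f$ denotes the set of points $y\in Y$ at which $f$ is not proper. Here $Y=\mathbb{C}^m$. *)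

theory Defs
  imports "HOL-Analysis.Analysis" "HOL-Library.Poly_Mapping"
    "HOL-Computational_Algebra.Polynomial"
begin

text \<open>Polynomials over \<open>\<complex>\<close> in finitely many variables indexed by \<open>'n\<close>, as finitely supported
  coefficient functions on exponent vectors.\<close>

type_synonym 'n cmpoly = "('n \<Rightarrow>\<^sub>0 nat) \<Rightarrow>\<^sub>0 complex"

definition mpoly_eval :: "'n::finite cmpoly \<Rightarrow> complex ^ 'n \<Rightarrow> complex" where
  "mpoly_eval p x =
    (\<Sum>\<alpha>\<in>Poly_Mapping.keys p. Poly_Mapping.lookup p \<alpha> * (\<Prod>i\<in>UNIV. x $ i ^ Poly_Mapping.lookup \<alpha> i))"

text \<open>The zero polynomial has degree \<open>0\<close> here, as it does in the library for univariate
  polynomials.\<close>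

definition mpoly_degree :: "'n::finite cmpoly \<Rightarrow> nat" where
  "mpoly_degree p =
    Max (insert 0 ((\<lambda>\<alpha>. \<Sum>i\<in>UNIV. Poly_Mapping.lookup \<alpha> i) ` Poly_Mapping.keys p))"

definition polymap_eval :: "'n::finite cmpoly ^ 'm::finite \<Rightarrow> complex ^ 'n \<Rightarrow> complex ^ 'm" where
  "polymap_eval F x = (\<chi> j. mpoly_eval (F $ j) x)"

definition polymap_degree :: "'n::finite cmpoly ^ 'm::finite \<Rightarrow> nat" where
  "polymap_degree F = Max (range (\<lambda>j. mpoly_degree (F $ j)))"

definition curve_eval :: "complex poly ^ 'm::finite \<Rightarrow> complex \<Rightarrow> complex ^ 'm" where
  "curve_eval l t = (\<chi> j. poly (l $ j) t)"

definition curve_degree :: "complex poly ^ 'm::finite \<Rightarrow> nat" where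
  "curve_degree l = Max (range (\<lambda>j. degree (l $ j)))"

definition zariski_closed :: "(complex ^ 'm::finite) set \<Rightarrow> bool" where
  "zariski_closed Z \<longleftrightarrow> (\<exists>I :: 'm cmpoly set. Z = {y. \<forall>p\<in>I. mpoly_eval p y = 0})"

text \<open>A property of fibers holds generally if it holds over a dense Zariski-open subset of the
  image.  For a polynomial map on \<open>\<complex>\<^sup>n\<close> the image is irreducible, so that a Zariski-open subset of
  it is dense as soon as it is nonempty.\<close>

definition generically_finite :: "(complex ^ 'n::finite \<Rightarrow> complex ^ 'm::finite) \<Rightarrow> bool" where
  "generically_finite f \<longleftrightarrow>
    (\<exists>Z. zariski_closed Z \<and> range f - Z \<noteq> {} \<and> (\<forall>y\<in>range f - Z. finite (f -` {y})))"

text \<open>The library's \<open>proper_map\<close> is a closed map with compact fibers; for continuous maps into a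
  locally compact Hausdorff space, as here, this is the same as compactness of preimages of compact
  sets.  Points outside the closure of the image are points of properness.\<close>

definition proper_at :: "('a::topological_space \<Rightarrow> 'b::topological_space) \<Rightarrow> 'b \<Rightarrow> bool" where
  "proper_at f y \<longleftrightarrow>
    (\<exists>U. open U \<and> y \<in> U \<and> proper_map (top_of_set (f -` U)) (top_of_set U) f)"

definition nonproper_set :: "('a::topological_space \<Rightarrow> 'b::topological_space) \<Rightarrow> 'b set" where
  "nonproper_set f = {y. \<not> proper_at f y}"

lemma mpoly_eval_poly_comp:
  "\<exists>q. \<forall>t. poly q t = mpoly_eval p (\<chi> i. poly (r i) t)"
  by (rule exI[of _ "\<Sum>\<alpha>\<in>Poly_Mapping.keys p. smult (Poly_Mapping.lookup p \<alpha>)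
        (\<Prod>i\<in>UNIV. r i ^ Poly_Mapping.lookup \<alpha> i)"])
     (simp add: mpoly_eval_def poly_sum poly_prod)

text \<open>Infinite fibers of a generically finite polynomial map cover only a nowhere dense subset of
  the source.\<close>

lemma generically_finite_nowhere_dense:
  fixes F :: "'n::finite cmpoly ^ 'm::finite"
  defines "f \<equiv> polymap_eval F"
  assumes "generically_finite f"
  shows "interior (closure {x. infinite (f -` {f x})}) = {}"
proof -
  obtain Z where Z: "zariski_closed Z" "range f - Z \<noteq> {}"
      and fin: "\<forall>y\<in>range f - Z. finite (f -` {y})"
    using assms(2) unfolding generically_finite_def by blast
  obtain I :: "'m cmpoly set" where I: "Z = {y. \<forall>p\<in>I. mpoly_eval p y = 0}"
    using Z(1) unfolding zariski_closed_def by blast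
  obtain p a where p: "p \<in> I" "mpoly_eval p (f a) \<noteq> 0"
    using Z(2) unfolding I by auto
  define S where "S = {x. mpoly_eval p (f x) = 0}"
  have cont: "continuous_on UNIV (\<lambda>x. mpoly_eval p (f x))"
    unfolding f_def polymap_eval_def mpoly_eval_def by (intro continuous_intros)
  have closed: "closed S"
    unfolding S_def using closed_Collect_eq[OF cont, of "\<lambda>_. 0"] by simp
  have sub: "{x. infinite (f -` {f x})} \<subseteq> S"
    using fin p(1) unfolding S_def I by auto
  have "interior S = {}"
  proof (rule ccontr)
    assume "interior S \<noteq> {}"
    then obtain b e where e: "e > 0" "ball b e \<subseteq> S"
      by (meson all_not_in_conv interior_subset open_contains_ball open_interior subset_trans)
    define c where "c t = b + (\<chi> i. t * (a $ i - b $ i))" for t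
    have c_eq: "c t = (\<chi> i. poly [:b $ i, a $ i - b $ i:] t)" for t
      by (simp add: c_def vec_eq_iff)
    have "\<forall>j. \<exists>q. \<forall>t. poly q t = mpoly_eval (F $ j) (c t)"
      unfolding c_eq by (intro allI mpoly_eval_poly_comp[where r = "\<lambda>i. [:b $ i, a $ i - b $ i:]"])
    then obtain q where q: "\<And>j t. poly (q j) t = mpoly_eval (F $ j) (c t)"
      by metis
    obtain g where g: "\<And>t. poly g t = mpoly_eval p (\<chi> j. poly (q j) t)"
      using mpoly_eval_poly_comp by metis
    have g_eq: "poly g t = mpoly_eval p (f (c t))" for t
      by (simp add: g q f_def polymap_eval_def)
    have "c 1 = a" by (simp add: c_def vec_eq_iff)
    then have "g \<noteq> 0" using g_eq[of 1] p(2) by auto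
    then have "finite {t. poly g t = 0}" by (rule poly_roots_finite)
    moreover have "{t. c t \<in> ball b e} \<subseteq> {t. poly g t = 0}"
      using e(2) by (auto simp: g_eq S_def)
    ultimately have "finite (c -` ball b e)"
      by (simp add: vimage_def finite_subset)
    moreover have "open (c -` ball b e)"
      unfolding c_def by (intro open_vimage continuous_intros open_ball)
    moreover have "0 \<in> c -` ball b e"
      using e(1) by (simp add: c_def vec_eq_iff flip: zero_vec_def)
    ultimately show False
      using finite_imp_not_open by blast
  qed
  moreover have "closure {x. infinite (f -` {f x})} \<subseteq> S"
    using sub closed by (rule closure_minimal)
  ultimately show ?thesis
    using interior_mono by blast
qed

end

theory Submission
  imports Defs "HOL-Complex_Analysis.Great_Picard"
begin

text \<open>Let \<open>f\<close> be the polynomial map and \<open>y \<in> S\<^sub>f\<close>, so that \<open>f (x\<^sub>k) \<longlonglongrightarrow> y\<close> for some sequence with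
  \<open>\<bar>x\<^sub>k\<bar> \<longlonglongrightarrow> \<infinity>\<close>.  For bounded directions \<open>v\<^sub>k\<close> write \<open>f (x\<^sub>k + t v\<^sub>k) = \<Sum>\<^sub>i a\<^sub>i\<^sub>k t\<^sup>i\<close>.  Here \<open>a\<^sub>0\<^sub>k\<close> is
  bounded, and so is \<open>a\<^sub>d\<^sub>k\<close>, which depends on \<open>v\<^sub>k\<close> only.  If the other coefficients were bounded for
  every choice of bounded directions, then \<open>f (x\<^sub>k + v\<^sub>k)\<close> would always be bounded, which for a polynomial
  map forces a period \<open>w \<noteq> 0\<close>, and hence infinite fibers everywhere.  So for suitable \<open>v\<^sub>k\<close> some \<open>a\<^sub>i\<^sub>k\<close>
  with \<open>0 < i < d\<close> is unbounded.  Rescaling \<open>t\<close> by \<open>s\<^sub>k \<in> [0, 1]\<close> with \<open>\<Sum> \<bar>a\<^sub>i\<^sub>k\<bar> s\<^sub>k\<^sup>i = 1\<close>, the sum being over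
  \<open>0 < i < d\<close>, makes the term of degree \<open>d\<close> tend to zero.  Along a subsequence the coefficients
  converge to those of a non-constant curve of degree at most \<open>d - 1\<close> through \<open>y\<close>.  Each of its points is
  the limit of \<open>f (x\<^sub>k + t s\<^sub>k v\<^sub>k)\<close>, where the arguments tend to infinity, and thus lies in \<open>S\<^sub>f\<close>.\<close>

section \<open>Vanishing iterated differences\<close>

text \<open>For polynomial maps the following says that the degree is less than \<open>n\<close>.\<close>

primrec vanishing_differences :: "nat \<Rightarrow> ('a::ab_group_add \<Rightarrow> 'b::ab_group_add) \<Rightarrow> bool" where
  "vanishing_differences 0 h \<longleftrightarrow> (\<forall>x. h x = 0)"
| "vanishing_differences (Suc n) h \<longleftrightarrow> (\<forall>v. vanishing_differences n (\<lambda>x. h (x + v) - h x))"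

lemma vanishing_differences_zero: "vanishing_differences n (\<lambda>x. 0)"
  by (induction n) auto

lemma vanishing_differences_Suc:
  "vanishing_differences n h \<Longrightarrow> vanishing_differences (Suc n) h"
proof (induction n arbitrary: h)
  case (Suc n)
  have "vanishing_differences (Suc n) (\<lambda>x. h (x + v) - h x)" for v
    using Suc.prems by (intro Suc.IH) simp
  then show ?case
    using vanishing_differences.simps(2) by blast
qed simp

lemma vanishing_differences_mono:
  "vanishing_differences m h \<Longrightarrow> m \<le> n \<Longrightarrow> vanishing_differences n h"
  by (induction n) (metis le_zero_eq, metis le_Suc_eq vanishing_differences_Suc)

lemma vanishing_differences_add:
  "vanishing_differences n h \<Longrightarrow> vanishing_differences n g \<Longrightarrow>
    vanishing_differences n (\<lambda>x. h x + g x)"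
proof (induction n arbitrary: h g)
  case (Suc n)
  have "vanishing_differences n (\<lambda>x. (h (x + v) - h x) + (g (x + v) - g x))" for v
    using Suc.prems by (intro Suc.IH) simp_all
  then show ?case
    by (simp add: algebra_simps)
qed simp

lemma vanishing_differences_translate:
  "vanishing_differences n h \<Longrightarrow> vanishing_differences n (\<lambda>x. h (x + u))"
proof (induction n arbitrary: h)
  case (Suc n)
  have "vanishing_differences n (\<lambda>x. h (x + u + v) - h (x + u))" for v
    using Suc.IH[of "\<lambda>x. h (x + v) - h x"] Suc.prems by simp
  then show ?case
    by (simp add: ac_simps)
qed simp

text \<open>The difference of a product is
  \<open>h (x + v) * (g (x + v) - g x) + (h (x + v) - h x) * g x\<close>. In each summand one factor
  loses one order, which allows induction on \<open>m + n\<close>.\<close>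

lemma vanishing_differences_mult:
  fixes h g :: "'a::ab_group_add \<Rightarrow> 'b::comm_ring"
  shows "vanishing_differences m h \<Longrightarrow> vanishing_differences n g \<Longrightarrow>
    vanishing_differences (m + n) (\<lambda>x. h x * g x)"
proof (induction "m + n" arbitrary: m n h g)
  case (Suc k)
  show ?case
  proof (cases "m = 0 \<or> n = 0")
    case True
    then have "(\<lambda>x. h x * g x) = (\<lambda>x. 0)"
      using Suc.prems by auto
    then show ?thesis
      by (simp add: vanishing_differences_zero)
  next
    case False
    then obtain m' n' where mn: "m = Suc m'" "n = Suc n'"
      by (meson not0_implies_Suc)
    have "vanishing_differences k (\<lambda>x. h (x + v) * g (x + v) - h x * g x)" for v
    proof -
      have 1: "vanishing_differences (m + n') (\<lambda>x. h (x + v) * (g (x + v) - g x))"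
        using Suc.prems Suc.hyps(2) mn
        by (intro Suc.hyps(1) vanishing_differences_translate) simp_all
      have 2: "vanishing_differences (m' + n) (\<lambda>x. (h (x + v) - h x) * g x)"
        using Suc.prems Suc.hyps(2) mn by (intro Suc.hyps(1)) simp_all
      have "m + n' = k" "m' + n = k"
        using Suc.hyps(2) mn by simp_all
      then show ?thesis
        using vanishing_differences_add[OF 1[unfolded \<open>m + n' = k\<close>] 2[unfolded \<open>m' + n = k\<close>]]
        by (simp add: algebra_simps)
    qed
    then show ?thesis
      by (simp flip: Suc.hyps(2))
  qed
qed simp

lemma vanishing_differences_vec:
  fixes h :: "'a::ab_group_add \<Rightarrow> 'b::ab_group_add ^ 'm"
  shows "(\<And>j. vanishing_differences n (\<lambda>x. h x $ j)) \<Longrightarrow> vanishing_differences n h"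
  by (induction n arbitrary: h) (simp_all add: vec_eq_iff)

lemma ex_vanishing_differences_const: "\<exists>n. vanishing_differences n (\<lambda>x. c)"
  by (rule exI[of _ "Suc 0"]) simp

lemma ex_vanishing_differences_add:
  "\<exists>n. vanishing_differences n h \<Longrightarrow> \<exists>n. vanishing_differences n g \<Longrightarrow>
    \<exists>n. vanishing_differences n (\<lambda>x. h x + g x)"
  by (elim exE, rule_tac x = "max n na" in exI)
    (intro vanishing_differences_add; erule vanishing_differences_mono; simp)

lemma ex_vanishing_differences_mult:
  fixes h g :: "'a::ab_group_add \<Rightarrow> 'b::comm_ring"
  shows "\<exists>n. vanishing_differences n h \<Longrightarrow> \<exists>n. vanishing_differences n g \<Longrightarrow>
    \<exists>n. vanishing_differences n (\<lambda>x. h x * g x)"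
  using vanishing_differences_mult by blast

lemma ex_vanishing_differences_sum:
  "finite A \<Longrightarrow> (\<And>a. a \<in> A \<Longrightarrow> \<exists>n. vanishing_differences n (h a)) \<Longrightarrow>
    \<exists>n. vanishing_differences n (\<lambda>x. \<Sum>a\<in>A. h a x)"
  by (induction A rule: finite_induct)
    (simp_all add: vanishing_differences_zero ex_vanishing_differences_add)

lemma ex_vanishing_differences_prod:
  fixes h :: "'i \<Rightarrow> 'a::ab_group_add \<Rightarrow> 'b::comm_ring_1"
  shows "finite A \<Longrightarrow> (\<And>a. a \<in> A \<Longrightarrow> \<exists>n. vanishing_differences n (h a)) \<Longrightarrow>
    \<exists>n. vanishing_differences n (\<lambda>x. \<Prod>a\<in>A. h a x)"
  by (induction A rule: finite_induct)
    (simp_all add: ex_vanishing_differences_mult ex_vanishing_differences_const)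

lemma ex_vanishing_differences_power:
  fixes h :: "'a::ab_group_add \<Rightarrow> 'b::comm_ring_1"
  shows "\<exists>n. vanishing_differences n h \<Longrightarrow> \<exists>n. vanishing_differences n (\<lambda>x. h x ^ k)"
  by (induction k) (simp_all add: ex_vanishing_differences_mult ex_vanishing_differences_const)

text \<open>Coordinates have order two, constants order one, and sums and products preserve finite
  order. The maximum over the finitely many components serves for the whole map.\<close>

lemma ex_vanishing_differences_polymap:
  fixes F :: "'n::finite cmpoly ^ 'm::finite"
  shows "\<exists>n. vanishing_differences n (polymap_eval F)"
proof -
  have coord: "\<exists>n. vanishing_differences n (\<lambda>x :: complex ^ 'n. x $ i)" for i :: 'n
    by (rule exI[of _ "Suc (Suc 0)"]) simp
  have "\<exists>n. vanishing_differences n (mpoly_eval (F $ j))" for j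
    unfolding mpoly_eval_def[abs_def]
    by (intro ex_vanishing_differences_sum ex_vanishing_differences_mult ex_vanishing_differences_prod
        ex_vanishing_differences_power coord finite finite_keys ex_vanishing_differences_const)
  then obtain N where N: "\<And>j. vanishing_differences (N j) (mpoly_eval (F $ j))"
    by metis
  have "vanishing_differences (Max (range N)) (polymap_eval F)"
    by (intro vanishing_differences_vec)
      (simp add: polymap_eval_def vanishing_differences_mono[OF N])
  then show ?thesis ..
qed

section \<open>Unbounded sequences and periods\<close>

text \<open>Cauchy's functional equation: additivity gives homogeneity for integers, then for
  rationals, and continuity extends it to the reals by density.\<close>

lemma additive_continuous_imp_linear:
  fixes f :: "'a::real_normed_vector \<Rightarrow> 'b::real_normed_vector"
  assumes add: "\<And>x y. f (x + y) = f x + f y" and cont: "continuous_on UNIV f"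
  shows "linear f"
proof (rule linearI)
  fix r :: real and x :: 'a
  interpret additive f
    by standard (rule add)
  have nat: "f (real n *\<^sub>R z) = real n *\<^sub>R f z" for n z
    by (induction n) (simp_all add: zero add algebra_simps)
  have int: "f (real_of_int k *\<^sub>R z) = real_of_int k *\<^sub>R f z" for k z
    by (cases k rule: int_cases2) (simp_all add: nat minus)
  have "f (r *\<^sub>R x) = r *\<^sub>R f x" if "r \<in> \<rat>" for r
    using that
  proof (cases r rule: Rats_cases')
    case (1 a b)
    have "real_of_int b *\<^sub>R f (r *\<^sub>R x) = f (real_of_int b *\<^sub>R r *\<^sub>R x)"
      by (rule int[symmetric])
    also have "\<dots> = real_of_int a *\<^sub>R f x"
      using 1 by (simp add: int)
    finally have "f (r *\<^sub>R x) = (1 / real_of_int b) *\<^sub>R (real_of_int a *\<^sub>R f x)"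
      using 1 by (metis divide_self_if less_irrefl of_int_0_less_iff scaleR_one scaleR_scaleR times_divide_eq_left mult_1)
    then show ?thesis
      using 1 by simp
  qed
  moreover have "closed {r. f (r *\<^sub>R x) = r *\<^sub>R f x}"
    by (intro closed_Collect_eq continuous_on_compose2[OF cont] continuous_intros) auto
  ultimately have "closure \<rat> \<subseteq> {r. f (r *\<^sub>R x) = r *\<^sub>R f x}"
    by (intro closure_minimal subsetI) blast+
  then show "f (r *\<^sub>R x) = r *\<^sub>R f x"
    by (auto simp: Rats_closure_real)
qed (fact add)

text \<open>The bounded perturbations make the condition invariant under changing \<open>x\<close> by a bounded
  sequence.\<close>

definition tame_along :: "(nat \<Rightarrow> 'a::real_normed_vector) \<Rightarrow> ('a \<Rightarrow> 'b::real_normed_vector) \<Rightarrow> bool" where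
  "tame_along x h \<longleftrightarrow> (\<exists>n. vanishing_differences n h) \<and> continuous_on UNIV h \<and>
    (\<forall>b. bounded (range b) \<longrightarrow> bounded (range (\<lambda>k. h (x k + b k))))"

lemma tame_along_shift:
  assumes "tame_along x h" "bounded (range b)"
  shows "tame_along (\<lambda>k. x k + b k) h"
  unfolding tame_along_def
proof (intro conjI allI impI)
  fix b' :: "nat \<Rightarrow> 'a"
  assume "bounded (range b')"
  then have "bounded (range (\<lambda>k. b k + b' k))"
    using assms(2) by (rule bounded_plus_comp[rotated])
  then have "bounded (range (\<lambda>k. h (x k + (b k + b' k))))"
    using assms(1) unfolding tame_along_def by blast
  then show "bounded (range (\<lambda>k. h (x k + b k + b' k)))"
    by (simp add: add.assoc)
qed (use assms(1) in \<open>auto simp: tame_along_def\<close>)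

text \<open>The constant sequence \<open>v\<close> is itself a bounded perturbation, so both terms
  of the difference stay bounded. This closure property is what makes a choice of minimal order
  useful below.\<close>

lemma tame_along_difference:
  assumes "tame_along x h"
  shows "tame_along x (\<lambda>y. h (y + v) - h y)"
  unfolding tame_along_def
proof (intro conjI allI impI)
  obtain n where "vanishing_differences n h"
    using assms unfolding tame_along_def by blast
  then have "vanishing_differences n (\<lambda>y. h (y + v) - h y)"
    using vanishing_differences_Suc vanishing_differences.simps(2) by blast
  then show "\<exists>n. vanishing_differences n (\<lambda>y. h (y + v) - h y)" ..
  show "continuous_on UNIV (\<lambda>y. h (y + v) - h y)"
    using assms unfolding tame_along_def
    by (intro continuous_on_diff) (auto intro!: continuous_on_compose2[of UNIV h] continuous_intros)
  fix b :: "nat \<Rightarrow> 'a"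
  assume b: "bounded (range b)"
  have "tame_along (\<lambda>k. x k + b k) h"
    using assms b by (rule tame_along_shift)
  moreover have "bounded (range (\<lambda>k::nat. v))" "bounded (range (\<lambda>k::nat. 0::'a))"
    by simp_all
  ultimately have "bounded (range (\<lambda>k. h (x k + b k + v)))" "bounded (range (\<lambda>k. h (x k + b k + 0)))"
    unfolding tame_along_def by blast+
  then show "bounded (range (\<lambda>k. h (x k + b k + v) - h (x k + b k)))"
    by (simp add: bounded_minus_comp)
qed

text \<open>A map in the class below that is not constant on \<open>S\<close>, but whose differences are, is affine on
  \<open>S\<close>.  It is bounded along \<open>x\<close>, so that up to a bounded sequence \<open>x\<close> lies in the kernel of its linear
  part, which is smaller than \<open>S\<close>.  If instead all maps of the class are constant on \<open>S\<close>, then applying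
  this to their differences shows that the elements of \<open>S\<close> are periods.\<close>

proposition unbounded_tame_imp_period:
  fixes x :: "nat \<Rightarrow> 'a::euclidean_space"
  assumes "subspace S" "\<And>k. x k \<in> S" "\<not> bounded (range x)"
  shows "\<exists>w. w \<noteq> 0 \<and> (\<forall>h :: 'a \<Rightarrow> 'b::euclidean_space. tame_along x h \<longrightarrow> (\<forall>y. h (y + w) = h y))"
  using assms
proof (induction "dim S" arbitrary: S x rule: less_induct)
  case less
  show ?case
  proof (cases "\<forall>h :: 'a \<Rightarrow> 'b. tame_along x h \<longrightarrow> (\<forall>z\<in>S. h z = h 0)")
    case True
    obtain k where k: "x k \<noteq> 0"
      using less.prems(3) by (metis bounded_iff order_refl rangeE)
    have "h (y + x k) = h y" if h: "tame_along x h" for h :: "'a \<Rightarrow> 'b" and y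
    proof -
      have "h (x k + y) - h (x k) = h (0 + y) - h 0"
        using True[rule_format, OF tame_along_difference[OF h] less.prems(2)] .
      moreover have "h (x k) = h 0"
        using True[rule_format, OF h less.prems(2)] .
      ultimately show ?thesis
        by (simp add: add.commute)
    qed
    then show ?thesis
      using k by blast
  next
    case False
    \<comment> \<open>A map of least order is chosen: its differences are tame of smaller order,
      hence constant on \<open>S\<close>.\<close>
    define Q where "Q n \<longleftrightarrow> (\<exists>h :: 'a \<Rightarrow> 'b. tame_along x h \<and> vanishing_differences n h \<and> (\<exists>z\<in>S. h z \<noteq> h 0))" for n
    have "\<exists>n. Q n"
      using False unfolding Q_def tame_along_def by blast
    then obtain n where n: "Q n" and min: "\<And>m. m < n \<Longrightarrow> \<not> Q m"
      using exists_least_iff[of Q] by blast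
    obtain h :: "'a \<Rightarrow> 'b" and z where h: "tame_along x h" "vanishing_differences n h"
        and z: "z \<in> S" "h z \<noteq> h 0"
      using n unfolding Q_def by blast
    obtain m where m: "n = Suc m"
      using h(2) z(2) by (cases n) auto
    have affine: "h (a + v) - h a = h v - h 0" if "a \<in> S" for a v
    proof -
      have "vanishing_differences m (\<lambda>y. h (y + v) - h y)"
        using h(2) m by simp
      with min[of m] m tame_along_difference[OF h(1), of v] that show ?thesis
        unfolding Q_def by fastforce
    qed
    \<comment> \<open>The linear retraction onto \<open>S\<close> extends the linear part of
      \<open>h\<close> from \<open>S\<close> to the whole space.\<close>
    obtain P :: "'a \<Rightarrow> 'a" where P: "range P \<subseteq> S" "linear P" "\<And>a. a \<in> S \<Longrightarrow> P a = a"
      using linear_exists_left_inverse_on[of id S] less.prems(1) by (auto simp: linear_id)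
    define l where "l y = h (P y) - h 0" for y
    have "linear l"
    proof (rule additive_continuous_imp_linear)
      show "l (a + b) = l a + l b" for a b
        using affine[of "P a" "P b"] P(1) by (auto simp: l_def linear_add[OF P(2)] algebra_simps)
      show "continuous_on UNIV l"
        unfolding l_def using h(1) P(2)
        by (auto simp: tame_along_def linear_continuous_on linear_linear
            intro!: continuous_intros continuous_on_compose2[of UNIV h])
    qed
    define S' where "S' = {y \<in> S. l y = 0}"
    have S': "subspace S'"
      unfolding S'_def using less.prems(1) \<open>linear l\<close>
      by (auto simp: subspace_def linear_add linear_cmul linear_0)
    have "z \<notin> S'"
      using z P(3) by (auto simp: S'_def l_def)
    have "S' \<subseteq> S"
      by (auto simp: S'_def)
    then have dim: "dim S' < dim S"
      using \<open>z \<notin> S'\<close> z(1) S' less.prems(1) by (metis subspace_dim_equal not_le)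
    \<comment> \<open>On the orthogonal complement of the kernel \<open>S'\<close> within
      \<open>S\<close>, \<open>l\<close> is injective and hence bounded below.\<close>
    define C where "C = {q \<in> S. \<forall>w\<in>S'. orthogonal q w}"
    have "subspace C"
      unfolding C_def using less.prems(1)
      by (auto simp: subspace_def orthogonal_clauses)
    moreover have "\<forall>q\<in>C. l q = 0 \<longrightarrow> q = 0"
      by (auto simp: C_def S'_def orthogonal_self)
    ultimately obtain e where e: "e > 0" "\<And>q. q \<in> C \<Longrightarrow> e * norm q \<le> norm (l q)"
      using injective_imp_isometric[of C l] \<open>linear l\<close> closed_subspace linear_linear by blast
    have "\<exists>p q. p \<in> S' \<and> q \<in> C \<and> x k = p + q" for k
    proof -
      obtain p q where pq: "p \<in> span S'" "\<And>w. w \<in> span S' \<Longrightarrow> orthogonal q w" "x k = p + q"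
        using orthogonal_subspace_decomp_exists[of S' "x k"] by blast
      then have "p \<in> S'"
        using S' by (simp add: span_eq_iff[THEN iffD2])
      moreover have "q \<in> S"
        using pq(3) less.prems(1,2) \<open>p \<in> S'\<close> \<open>S' \<subseteq> S\<close>
        by (metis add_diff_cancel_left' subsetD subspace_diff)
      ultimately show ?thesis
        using pq(2,3) span_base unfolding C_def by blast
    qed
    then obtain p q where p: "\<And>k. p k \<in> S'" and q: "\<And>k. q k \<in> C" and x: "\<And>k. x k = p k + q k"
      by metis
    \<comment> \<open>The zero perturbation bounds \<open>h\<close> along \<open>x\<close>. As
      \<open>l\<close> kills \<open>p k\<close>, this bounds \<open>l (q k)\<close> and with it
      \<open>q k\<close>.\<close>
    have "bounded (range (\<lambda>k. h (x k + 0)))"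
      using h(1) unfolding tame_along_def by (elim conjE allE[of _ "\<lambda>k. 0"]) simp
    then obtain B where B: "\<And>k. norm (h (x k)) \<le> B"
      unfolding bounded_iff by auto
    have "norm (q k) \<le> (B + norm (h 0)) / e" for k
    proof -
      have "l (q k) = l (x k)"
        using p[of k] by (simp add: x linear_add[OF \<open>linear l\<close>] S'_def)
      also have "\<dots> = h (x k) - h 0"
        using P(3) less.prems(2) by (simp add: l_def)
      finally have "e * norm (q k) \<le> B + norm (h 0)"
        using e(2)[OF q[of k]] norm_triangle_ineq4[of "h (x k)" "h 0"] B[of k] by simp
      then show ?thesis
        using e(1) by (simp add: field_simps)
    qed
    then have q_bdd: "bounded (range q)"
      unfolding bounded_iff by blast
    have p_eq: "p = (\<lambda>k. x k + (- q k))"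
      by (simp add: x)
    have "\<not> bounded (range p)"
    proof
      assume "bounded (range p)"
      then have "bounded (range (\<lambda>k. p k + q k))"
        using q_bdd by (rule bounded_plus_comp)
      then show False
        using less.prems(3) by (simp flip: x)
    qed
    from less.hyps[OF dim S' p this] obtain w where
      w: "w \<noteq> 0" "\<And>h :: 'a \<Rightarrow> 'b. tame_along p h \<Longrightarrow> \<forall>y. h (y + w) = h y"
      by blast
    \<comment> \<open>The sequences \<open>x\<close> and \<open>p\<close> differ by a bounded one,
      so a common period of the maps tame along \<open>p\<close> serves for \<open>x\<close>
      too.\<close>
    have "tame_along p h" if "tame_along x h" for h :: "'a \<Rightarrow> 'b"
      unfolding p_eq using q_bdd by (intro tame_along_shift that) simp
    then show ?thesis
      using w by blast
  qed
qed

section \<open>Restrictions of polynomials to lines\<close>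

text \<open>The coefficient of \<open>t\<^sup>d\<close> depends only on the direction of the line.\<close>

definition polynomial_on_lines :: "nat \<Rightarrow> (complex ^ 'n::finite \<Rightarrow> complex) \<Rightarrow> bool" where
  "polynomial_on_lines d h \<longleftrightarrow> (\<exists>q c. continuous_on UNIV c \<and>
    (\<forall>x v. (\<forall>t. h (x + t *s v) = poly (q x v) t) \<and> degree (q x v) \<le> d \<and> coeff (q x v) d = c v))"

lemma polynomial_on_lines_const: "polynomial_on_lines 0 (\<lambda>x. a)"
  unfolding polynomial_on_lines_def
  by (rule exI[of _ "\<lambda>x v. [:a:]"], rule exI[of _ "\<lambda>v. a"]) simp

lemma polynomial_on_lines_component: "polynomial_on_lines 1 (\<lambda>x. x $ i)"
  unfolding polynomial_on_lines_def
  by (rule exI[of _ "\<lambda>x v. [:x $ i, v $ i:]"], rule exI[of _ "\<lambda>v. v $ i"])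
    (auto intro!: continuous_intros)

lemma polynomial_on_lines_mono:
  assumes "polynomial_on_lines d h" "d \<le> e"
  shows "polynomial_on_lines e h"
proof (cases "d = e")
  case False
  obtain q where q: "\<And>x v t. h (x + t *s v) = poly (q x v) t" "\<And>x v. degree (q x v) \<le> d"
    using assms(1) unfolding polynomial_on_lines_def by blast
  have "degree (q x v) < e" for x v
    using q(2)[of x v] assms(2) False by linarith
  then show ?thesis
    unfolding polynomial_on_lines_def
    by (intro exI[of _ q] exI[of _ "\<lambda>v. 0"]) (simp add: q(1) coeff_eq_0 less_imp_le)
qed (use assms in simp)

lemma polynomial_on_lines_add:
  assumes "polynomial_on_lines d h" "polynomial_on_lines d g"
  shows "polynomial_on_lines d (\<lambda>x. h x + g x)"
proof -
  obtain q c q' c' where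
    "continuous_on UNIV c" "continuous_on UNIV c'"
    "\<And>x v t. h (x + t *s v) = poly (q x v) t" "\<And>x v t. g (x + t *s v) = poly (q' x v) t"
    "\<And>x v. degree (q x v) \<le> d" "\<And>x v. degree (q' x v) \<le> d"
    "\<And>x v. coeff (q x v) d = c v" "\<And>x v. coeff (q' x v) d = c' v"
    using assms unfolding polynomial_on_lines_def by metis
  then show ?thesis
    unfolding polynomial_on_lines_def
    by (intro exI[of _ "\<lambda>x v. q x v + q' x v"] exI[of _ "\<lambda>v. c v + c' v"])
      (simp add: continuous_on_add degree_add_le)
qed

text \<open>For \<open>i \<noteq> a\<close> either \<open>i\<close> exceeds the degree of
  \<open>p\<close> or \<open>a + b - i\<close> that of \<open>q\<close>, so one term of the
  convolution is left.\<close>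

lemma coeff_mult_le_degree:
  fixes p q :: "'a::comm_semiring_0 poly"
  assumes "degree p \<le> a" "degree q \<le> b"
  shows "coeff (p * q) (a + b) = coeff p a * coeff q b"
proof -
  have "coeff p i * coeff q (a + b - i) = 0" if "i \<noteq> a" for i
  proof (cases "i < a")
    case True
    then show ?thesis
      using assms(2) by (simp add: coeff_eq_0)
  next
    case False
    then show ?thesis
      using assms(1) that by (simp add: coeff_eq_0)
  qed
  then have "(\<Sum>i\<le>a + b. coeff p i * coeff q (a + b - i)) = (\<Sum>i\<in>{a}. coeff p i * coeff q (a + b - i))"
    by (intro sum.mono_neutral_right) auto
  then show ?thesis
    by (simp add: coeff_mult)
qed

lemma polynomial_on_lines_mult:
  assumes "polynomial_on_lines d h" "polynomial_on_lines e g"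
  shows "polynomial_on_lines (d + e) (\<lambda>x. h x * g x)"
proof -
  obtain q c q' c' where
    "continuous_on UNIV c" "continuous_on UNIV c'"
    "\<And>x v t. h (x + t *s v) = poly (q x v) t" "\<And>x v t. g (x + t *s v) = poly (q' x v) t"
    "\<And>x v. degree (q x v) \<le> d" "\<And>x v. degree (q' x v) \<le> e"
    "\<And>x v. coeff (q x v) d = c v" "\<And>x v. coeff (q' x v) e = c' v"
    using assms unfolding polynomial_on_lines_def by metis
  then show ?thesis
    unfolding polynomial_on_lines_def
    by (intro exI[of _ "\<lambda>x v. q x v * q' x v"] exI[of _ "\<lambda>v. c v * c' v"])
      (simp add: continuous_on_mult coeff_mult_le_degree order_trans[OF degree_mult_le] add_mono)
qed

lemma polynomial_on_lines_power:
  "polynomial_on_lines d h \<Longrightarrow> polynomial_on_lines (k * d) (\<lambda>x. h x ^ k)"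
  by (induction k) (simp_all add: polynomial_on_lines_const polynomial_on_lines_mult)

lemma polynomial_on_lines_prod:
  "finite A \<Longrightarrow> (\<And>a. a \<in> A \<Longrightarrow> polynomial_on_lines (d a) (h a)) \<Longrightarrow>
    polynomial_on_lines (\<Sum>a\<in>A. d a) (\<lambda>x. \<Prod>a\<in>A. h a x)"
  by (induction A rule: finite_induct)
    (simp_all add: polynomial_on_lines_const polynomial_on_lines_mult)

lemma polynomial_on_lines_sum:
  "finite A \<Longrightarrow> (\<And>a. a \<in> A \<Longrightarrow> polynomial_on_lines d (h a)) \<Longrightarrow>
    polynomial_on_lines d (\<lambda>x. \<Sum>a\<in>A. h a x)"
  by (induction A rule: finite_induct)
    (simp_all add: polynomial_on_lines_mono[OF polynomial_on_lines_const] polynomial_on_lines_add)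

text \<open>Each monomial is a product of coordinate powers whose exponents sum to at most
  \<open>d\<close>. The resulting top coefficient is, as a function of the direction, the
  homogeneous part of degree \<open>d\<close>.\<close>

lemma polynomial_on_lines_mpoly_eval:
  assumes "mpoly_degree p \<le> d"
  shows "polynomial_on_lines d (mpoly_eval p)"
  unfolding mpoly_eval_def[abs_def]
proof (rule polynomial_on_lines_sum)
  fix \<alpha> assume \<alpha>: "\<alpha> \<in> Poly_Mapping.keys p"
  have "polynomial_on_lines (Poly_Mapping.lookup \<alpha> i) (\<lambda>x. x $ i ^ Poly_Mapping.lookup \<alpha> i)" for i
    using polynomial_on_lines_power[OF polynomial_on_lines_component, of "Poly_Mapping.lookup \<alpha> i" i] by simp
  then have "polynomial_on_lines (\<Sum>i\<in>UNIV. Poly_Mapping.lookup \<alpha> i)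
      (\<lambda>x. \<Prod>i\<in>UNIV. x $ i ^ Poly_Mapping.lookup \<alpha> i)"
    by (intro polynomial_on_lines_prod) auto
  from polynomial_on_lines_mult[OF polynomial_on_lines_const this]
  have "polynomial_on_lines (\<Sum>i\<in>UNIV. Poly_Mapping.lookup \<alpha> i)
      (\<lambda>x. Poly_Mapping.lookup p \<alpha> * (\<Prod>i\<in>UNIV. x $ i ^ Poly_Mapping.lookup \<alpha> i))"
    by simp
  moreover have "(\<Sum>i\<in>UNIV. Poly_Mapping.lookup \<alpha> i) \<le> mpoly_degree p"
    unfolding mpoly_degree_def using \<alpha> by (intro Max_ge) auto
  ultimately show "polynomial_on_lines d
      (\<lambda>x. Poly_Mapping.lookup p \<alpha> * (\<Prod>i\<in>UNIV. x $ i ^ Poly_Mapping.lookup \<alpha> i))"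
    using assms by (blast intro: polynomial_on_lines_mono order_trans)
qed simp

section \<open>Curves in the set of non-properness\<close>

text \<open>If no such sequence exists, a small closed ball about \<open>y\<close> has bounded,
  hence compact preimage, and a continuous map from a compact space to a Hausdorff space is proper.
  Conversely, properness makes the preimage of some closed ball compact, and a sequence tending to
  infinity must leave it.\<close>

lemma nonproper_set_eq:
  fixes f :: "'a::euclidean_space \<Rightarrow> 'b::euclidean_space"
  assumes cont: "continuous_on UNIV f"
  shows "nonproper_set f =
    {y. \<exists>x :: nat \<Rightarrow> 'a. filterlim (\<lambda>k. norm (x k)) at_top sequentially \<and> (\<lambda>k. f (x k)) \<longlonglongrightarrow> y}"
proof (intro set_eqI iffI)
  fix y
  assume y: "y \<in> nonproper_set f"
  have "\<exists>x. dist (f x) y < 1 / real (Suc k) \<and> norm x > real k" for k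
  proof (rule ccontr)
    assume *: "\<not> ?thesis"
    define e where "e = 1 / real (Suc k)"
    have e: "e > 0"
      by (simp add: e_def)
    define C where "C = f -` cball y (e / 2)"
    have "bounded C"
    proof (rule boundedI)
      fix x assume "x \<in> C"
      then have "dist (f x) y \<le> e / 2"
        by (simp add: C_def dist_commute)
      also have "\<dots> < e"
        using e by simp
      finally have "dist (f x) y < 1 / real (Suc k)"
        unfolding e_def .
      with * show "norm x \<le> real k"
        using not_less by blast
    qed
    moreover have "closed C"
      unfolding C_def using cont by (intro closed_vimage) auto
    ultimately have "compact C"
      by (simp add: compact_eq_bounded_closed)
    then have "compact_space (top_of_set C)"
      by (simp add: compact_space_subtopology)
    moreover have "kc_space (top_of_set (cball y (e / 2)))"
      by (intro kc_space_subtopology kc_space_euclidean)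
    moreover have "continuous_map (top_of_set C) (top_of_set (cball y (e / 2))) f"
      unfolding continuous_map_in_subtopology continuous_map_iff_continuous
      using continuous_on_subset[OF cont] by (simp add: C_def image_subset_iff)
    ultimately have "proper_map (top_of_set C) (top_of_set (cball y (e / 2))) f"
      by (rule continuous_imp_proper_map)
    \<comment> \<open>\<open>proper_at\<close> asks for an open neighborhood, so properness is
      restricted from the closed ball to the open one.\<close>
    then have "proper_map (subtopology (top_of_set C) (f -` ball y (e / 2)))
        (subtopology (top_of_set (cball y (e / 2))) (ball y (e / 2))) f"
      by (rule proper_map_restriction)
        (auto simp: C_def simp del: mem_ball mem_cball dest: subsetD[OF ball_subset_cball])
    moreover have "C \<inter> f -` ball y (e / 2) = f -` ball y (e / 2)"
      "cball y (e / 2) \<inter> ball y (e / 2) = ball y (e / 2)"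
      by (auto simp: C_def simp del: mem_ball mem_cball dest: subsetD[OF ball_subset_cball])
    ultimately have "proper_map (top_of_set (f -` ball y (e / 2))) (top_of_set (ball y (e / 2))) f"
      by (simp add: subtopology_subtopology)
    moreover have "y \<in> ball y (e / 2)"
      using e by simp
    ultimately have "proper_at f y"
      unfolding proper_at_def by blast
    then show False
      using y by (simp add: nonproper_set_def)
  qed
  then obtain x where x: "\<And>k. dist (f (x k)) y < 1 / real (Suc k)" "\<And>k. norm (x k) > real k"
    by metis
  have "filterlim (\<lambda>k. norm (x k)) at_top sequentially"
    by (rule filterlim_at_top_mono[OF filterlim_real_sequentially]) (simp add: x(2) less_imp_le)
  moreover have "(\<lambda>k. f (x k)) \<longlonglongrightarrow> y"
    by (rule LIM_zero_cancel, rule LIMSEQ_norm_0) (metis dist_norm x(1))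
  ultimately show "y \<in> {y. \<exists>x :: nat \<Rightarrow> 'a. filterlim (\<lambda>k. norm (x k)) at_top sequentially \<and> (\<lambda>k. f (x k)) \<longlonglongrightarrow> y}"
    by blast
next
  fix y
  assume "y \<in> {y. \<exists>x :: nat \<Rightarrow> 'a. filterlim (\<lambda>k. norm (x k)) at_top sequentially \<and> (\<lambda>k. f (x k)) \<longlonglongrightarrow> y}"
  then obtain x :: "nat \<Rightarrow> 'a" where x: "filterlim (\<lambda>k. norm (x k)) at_top sequentially"
      and lim: "(\<lambda>k. f (x k)) \<longlonglongrightarrow> y"
    by blast
  have False if proper_at: "proper_at f y"
  proof -
    obtain U where U: "open U" "y \<in> U" and proper: "proper_map (top_of_set (f -` U)) (top_of_set U) f"
      using proper_at unfolding proper_at_def by blast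
    obtain e where e: "e > 0" "cball y e \<subseteq> U"
      using U by (meson open_contains_cball)
    have "compactin (top_of_set U) (cball y e)"
      using e(2) by (simp add: compactin_subtopology)
    from compactin_proper_map_preimage[OF proper this] have "compact {x \<in> f -` U. f x \<in> cball y e}"
      by (simp add: compactin_subtopology)
    from compact_imp_bounded[OF this] obtain B
      where B: "\<And>x. f x \<in> U \<Longrightarrow> f x \<in> cball y e \<Longrightarrow> norm x \<le> B"
      unfolding bounded_iff by auto
    have "eventually (\<lambda>k. f (x k) \<in> cball y e) sequentially"
      using tendstoD[OF lim e(1)] by eventually_elim (simp add: dist_commute)
    moreover have "eventually (\<lambda>k. norm (x k) > B) sequentially"
      using x by (simp add: filterlim_at_top_dense)
    ultimately have "eventually (\<lambda>k. False) sequentially"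
    proof eventually_elim
      case (elim k)
      then show False
        using B[of "x k"] e(2) by auto
    qed
    then show False
      by simp
  qed
  then show "y \<in> nonproper_set f"
    by (auto simp: nonproper_set_def)
qed

text \<open>For \<open>w \<noteq> 0\<close> the points \<open>a + real n *\<^sub>R w\<close> are
  pairwise distinct and lie in one fiber; generic finiteness supplies an \<open>a\<close> whose
  fiber is finite.\<close>

lemma generically_finite_imp_no_period:
  fixes f :: "complex ^ 'n::finite \<Rightarrow> complex ^ 'm::finite"
  assumes "generically_finite f" "\<And>y. f (y + w) = f y"
  shows "w = 0"
proof (rule ccontr)
  assume "w \<noteq> 0"
  obtain a where fin: "finite (f -` {f a})"
    using assms(1) unfolding generically_finite_def by blast
  have "f (a + real n *\<^sub>R w) = f a" for n
  proof (induction n)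
    case (Suc n)
    have "f (a + real (Suc n) *\<^sub>R w) = f ((a + real n *\<^sub>R w) + w)"
      by (simp add: algebra_simps)
    then show ?case
      using assms(2) Suc.IH by simp
  qed simp
  then have "range (\<lambda>n. a + real n *\<^sub>R w) \<subseteq> f -` {f a}"
    by auto
  moreover have "inj (\<lambda>n. a + real n *\<^sub>R w)"
    using \<open>w \<noteq> 0\<close> by (auto simp: inj_def)
  ultimately show False
    using fin finite_subset range_inj_infinite by blast
qed

lemma continuous_on_polymap_eval: "continuous_on A (polymap_eval F)"
  unfolding polymap_eval_def[abs_def] mpoly_eval_def by (intro continuous_intros)

lemma bounded_range_continuous:
  fixes c :: "'a::heine_borel \<Rightarrow> 'b::metric_space" and v :: "'i \<Rightarrow> 'a"
  assumes "continuous_on UNIV c" "bounded (range v)"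
  shows "bounded (range (\<lambda>k. c (v k)))"
proof -
  have "compact (c ` closure (range v))"
    using assms by (intro compact_continuous_image) (auto intro: continuous_on_subset)
  then have "bounded (c ` closure (range v))"
    by (rule compact_imp_bounded)
  then show ?thesis
    by (rule bounded_subset) (use closure_subset[of "range v"] in auto)
qed

lemma norm_vec_le_sum: "norm (z :: 'a::real_normed_vector ^ 'm::finite) \<le> (\<Sum>j\<in>UNIV. norm (z $ j))"
  unfolding norm_vec_def by (rule L2_set_le_sum) simp

lemma norm_vector_scalar_mult:
  "norm (a *s z) = norm a * norm z" for z :: "'a::real_normed_field ^ 'm::finite"
  by (simp add: norm_vec_def norm_mult L2_set_right_distrib)

lemma bounded_range_sum:
  fixes g :: "'i \<Rightarrow> 'k \<Rightarrow> 'b::real_normed_vector"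
  shows "finite A \<Longrightarrow> (\<And>i. i \<in> A \<Longrightarrow> bounded (range (g i))) \<Longrightarrow> bounded (range (\<lambda>k. \<Sum>i\<in>A. g i k))"
  by (induction A rule: finite_induct) (simp_all add: bounded_plus_comp)

lemma poly_eq_sum_atMost:
  fixes p :: "'a::comm_semiring_1 poly"
  assumes "degree p \<le> d"
  shows "poly p x = (\<Sum>i\<le>d. coeff p i * x ^ i)"
  unfolding poly_altdef by (rule sum.mono_neutral_left) (use assms in \<open>auto simp: coeff_eq_0\<close>)

text \<open>The outer coefficients are bounded: those of degree \<open>0\<close> are the components
  of \<open>polymap_eval F (x k)\<close>, those of degree \<open>d\<close> are continuous in
  \<open>v k\<close>. If the inner ones were always bounded too, the map would be tame along
  \<open>x\<close> and have a nonzero period.\<close>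

lemma unbounded_inner_coefficients:
  fixes F :: "'n::finite cmpoly ^ 'm::finite" and x :: "nat \<Rightarrow> complex ^ 'n"
    and q :: "'m \<Rightarrow> complex ^ 'n \<Rightarrow> complex ^ 'n \<Rightarrow> complex poly"
  assumes gf: "generically_finite (polymap_eval F)"
    and x: "\<not> bounded (range x)" "bounded (range (\<lambda>k. polymap_eval F (x k)))"
    and q: "\<And>j x v t. poly (q j x v) t = polymap_eval F (x + t *s v) $ j"
    and deg: "\<And>j x v. degree (q j x v) \<le> d"
    and c: "\<And>j x v. coeff (q j x v) d = c j v" "\<And>j. continuous_on UNIV (c j)"
  shows "\<exists>v. bounded (range v) \<and>
    \<not> bounded (range (\<lambda>k. \<Sum>j\<in>UNIV. \<Sum>i\<in>{1..<d}. norm (coeff (q j (x k) (v k)) i)))"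
proof (rule ccontr)
  let ?f = "polymap_eval F"
  let ?M = "\<lambda>v k. \<Sum>j\<in>UNIV. \<Sum>i\<in>{1..<d}. norm (coeff (q j (x k) (v k)) i)"
  assume *: "\<not> ?thesis"
  have bdd: "bounded (range (\<lambda>k. ?f (x k + v k)))" if v: "bounded (range v)" for v
  proof -
    define U where "U k = (\<Sum>j\<in>UNIV. norm (?f (x k) $ j)) + ?M v k + (\<Sum>j\<in>UNIV. norm (c j (v k)))" for k
    have le: "norm (?f (x k + v k)) \<le> U k" for k
    proof -
      have "norm (?f (x k + v k) $ j) \<le> norm (?f (x k) $ j)
          + (\<Sum>i\<in>{1..<d}. norm (coeff (q j (x k) (v k)) i)) + norm (c j (v k))" for j
      proof -
        let ?a = "\<lambda>i. norm (coeff (q j (x k) (v k)) i)"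
        have "?f (x k + v k) $ j = poly (q j (x k) (v k)) 1"
          by (simp add: q)
        also have "\<dots> = (\<Sum>i\<le>d. coeff (q j (x k) (v k)) i)"
          using poly_eq_sum_atMost[OF deg] by simp
        finally have "norm (?f (x k + v k) $ j) \<le> (\<Sum>i\<le>d. ?a i)"
          by (simp add: norm_sum)
        also have "\<dots> \<le> (\<Sum>i\<in>insert 0 (insert d {1..<d}). ?a i)"
          by (rule sum_mono2) auto
        \<comment> \<open>An inequality, since for \<open>d = 0\<close> the indices \<open>0\<close>
          and \<open>d\<close> coincide and the right-hand side counts the term twice.\<close>
        also have "\<dots> \<le> ?a 0 + (?a d + (\<Sum>i\<in>{1..<d}. ?a i))"
          by (auto simp: sum.insert_if)
        also have "?a 0 = norm (?f (x k) $ j)"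
          using q[of j "x k" "v k" 0] by (simp add: poly_0_coeff_0)
        finally show ?thesis
          by (simp add: c)
      qed
      then have "(\<Sum>j\<in>UNIV. norm (?f (x k + v k) $ j)) \<le> (\<Sum>j\<in>UNIV. norm (?f (x k) $ j)
          + (\<Sum>i\<in>{1..<d}. norm (coeff (q j (x k) (v k)) i)) + norm (c j (v k)))"
        by (intro sum_mono)
      then show ?thesis
        unfolding U_def using norm_vec_le_sum[of "?f (x k + v k)"] by (simp add: sum.distrib)
    qed
    have "bounded (range (\<lambda>k. norm (?f (x k) $ j)))" for j
      using bounded_component_cart[OF x(2), of j] by (simp add: bounded_norm_comp image_image)
    moreover have "bounded (range (\<lambda>k. norm (c j (v k))))" for j
      using bounded_range_continuous[OF c(2) v] by (simp add: bounded_norm_comp)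
    moreover have "bounded (range (?M v))"
      using * v by blast
    ultimately have "bounded (range U)"
      unfolding U_def by (intro bounded_plus_comp) (simp_all add: bounded_range_sum)
    then obtain B where B: "\<And>k. norm (U k) \<le> B"
      unfolding bounded_iff by auto
    have "norm (?f (x k + v k)) \<le> B" for k
      using le[of k] B[of k] by simp
    then show ?thesis
      unfolding bounded_iff by auto
  qed
  have "tame_along x ?f"
    unfolding tame_along_def
  proof (intro conjI)
    show "\<exists>n. vanishing_differences n ?f"
      by (rule ex_vanishing_differences_polymap)
    show "continuous_on UNIV ?f"
      by (rule continuous_on_polymap_eval)
    show "\<forall>b. bounded (range b) \<longrightarrow> bounded (range (\<lambda>k. ?f (x k + b k)))"
      using bdd by blast
  qed
  moreover obtain w where "w \<noteq> 0"
    "\<And>h :: complex ^ 'n \<Rightarrow> complex ^ 'm. tame_along x h \<Longrightarrow> \<forall>y. h (y + w) = h y"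
    using unbounded_tame_imp_period[OF subspace_UNIV UNIV_I x(1), where 'b = "complex ^ 'm"]
    by (elim exE conjE) (metis (no_types))
  ultimately show False
    using generically_finite_imp_no_period[OF gf, of w] by blast
qed

theorem theorem3p2:
  fixes F :: "'n::finite cmpoly ^ 'm::finite" and d :: nat
  assumes "generically_finite (polymap_eval F)"
    and "polymap_degree F = d"
  shows "\<forall>y \<in> nonproper_set (polymap_eval F).
    \<exists>l :: complex poly ^ 'm.
      \<not> curve_eval l constant_on UNIV \<and>
      curve_degree l \<le> d - 1 \<and>
      range (curve_eval l) \<subseteq> nonproper_set (polymap_eval F) \<and>
      y \<in> range (curve_eval l)"
proof
  let ?f = "polymap_eval F"
  note nonproper = nonproper_set_eq[OF continuous_on_polymap_eval[of UNIV F]]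
  fix y
  assume "y \<in> nonproper_set ?f"
  then obtain x :: "nat \<Rightarrow> complex ^ 'n" where
    x: "filterlim (\<lambda>k. norm (x k)) at_top sequentially" and fx: "(\<lambda>k. ?f (x k)) \<longlonglongrightarrow> y"
    unfolding nonproper by blast

  \<comment> \<open>Lines with unbounded inner coefficients\<close>
  have "polynomial_on_lines d (mpoly_eval (F $ j))" for j
    using assms(2) unfolding polymap_degree_def
    by (intro polynomial_on_lines_mpoly_eval) auto
  then have "\<forall>j. \<exists>q c. continuous_on UNIV c \<and> (\<forall>x v. (\<forall>t. mpoly_eval (F $ j) (x + t *s v) = poly (q x v) t) \<and>
      degree (q x v) \<le> d \<and> coeff (q x v) d = c v)"
    unfolding polynomial_on_lines_def by blast
  then obtain q c where
    q: "\<And>j x v t. poly (q j x v) t = ?f (x + t *s v) $ j"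
      and deg: "\<And>j x v. degree (q j x v) \<le> d"
      and c: "\<And>j x v. coeff (q j x v) d = c j v" "\<And>j. continuous_on UNIV (c j)"
    unfolding polymap_eval_def by (simp only: vec_lambda_beta) metis
  have "\<not> bounded (range x)"
  proof
    assume "bounded (range x)"
    then obtain B where "\<And>k. norm (x k) \<le> B"
      unfolding bounded_iff by auto
    moreover have "eventually (\<lambda>k. B < norm (x k)) sequentially"
      using x by (simp add: filterlim_at_top_dense)
    ultimately show False
      using eventually_happens' not_le by (metis sequentially_bot)
  qed
  from unbounded_inner_coefficients[OF assms(1) this convergent_imp_bounded[OF fx] q deg c]
  obtain v where v: "bounded (range v)" and
    unbdd: "\<not> bounded (range (\<lambda>k. \<Sum>j\<in>UNIV. \<Sum>i\<in>{1..<d}. norm (coeff (q j (x k) (v k)) i)))"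
    by blast
  define M where "M k = (\<Sum>j\<in>UNIV. \<Sum>i\<in>{1..<d}. norm (coeff (q j (x k) (v k)) i))" for k
  have M_nonneg: "M k \<ge> 0" for k
    unfolding M_def by (intro sum_nonneg) auto
  have M_large: "\<exists>k. M k > B" for B
    using unbdd M_nonneg unfolding M_def[symmetric] bounded_iff by (auto simp: not_le)
  \<comment> \<open>The sum forces \<open>k > n\<close>.\<close>
  then have "\<exists>k. M k > real (Suc n) + (\<Sum>i\<le>n. M i)" for n
    by blast
  then obtain r where r: "\<And>n. M (r n) > real (Suc n) + (\<Sum>i\<le>n. M i)"
    by metis
  have "r n \<ge> n" for n
  proof (rule ccontr)
    assume "\<not> n \<le> r n"
    then have "M (r n) \<le> (\<Sum>i\<le>n. M i)"
      by (intro member_le_sum) (auto simp: M_nonneg)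
    then show False
      using r[of n] by simp
  qed
  then have r_top: "filterlim r at_top sequentially"
    by (intro filterlim_at_top_mono[OF filterlim_ident]) (simp add: always_eventually)
  have M_r: "M (r n) > real (Suc n)" for n
    using r[of n] sum_nonneg[of "{..n}" M] M_nonneg by force
  \<comment> \<open>For \<open>d = 0\<close> the inner sum is empty and \<open>M\<close> vanishes,
    contrary to its growth along \<open>r\<close>.\<close>
  have "d \<ge> 1"
  proof (rule ccontr)
    assume "\<not> 1 \<le> d"
    then show False
      using M_r[of 0] by (simp add: M_def)
  qed

  \<comment> \<open>Rescaling the parameter\<close>
  define a where "a n j i = coeff (q j (x (r n)) (v (r n))) i" for n j i
  \<comment> \<open>Every exponent is positive, so the sum is \<open>0\<close> at
    \<open>s = 0\<close>; at \<open>s = 1\<close> it is \<open>M (r n) > 1\<close>. The intermediate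
    value theorem gives the scale.\<close>
  have "\<exists>s. 0 \<le> s \<and> s \<le> 1 \<and> (\<Sum>j\<in>UNIV. \<Sum>i\<in>{1..<d}. norm (a n j i) * s ^ i) = 1" for n
  proof (rule IVT')
    show "(\<Sum>j\<in>UNIV. \<Sum>i\<in>{1..<d}. norm (a n j i) * 0 ^ i) \<le> 1"
      by (simp add: power_0_left)
    show "1 \<le> (\<Sum>j\<in>UNIV. \<Sum>i\<in>{1..<d}. norm (a n j i) * 1 ^ i)"
      using M_r[of n] by (simp add: M_def a_def)
  qed (auto intro!: continuous_intros)
  then have "\<forall>n. \<exists>s. 0 \<le> s \<and> s \<le> 1 \<and> (\<Sum>j\<in>UNIV. \<Sum>i\<in>{1..<d}. norm (a n j i) * s ^ i) = 1" ..
  from choice[OF this] obtain s where s: "\<And>n. 0 \<le> s n" "\<And>n. s n \<le> 1"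
    "\<And>n. (\<Sum>j\<in>UNIV. \<Sum>i\<in>{1..<d}. norm (a n j i) * s n ^ i) = 1"
    by blast
  \<comment> \<open>As \<open>s n \<le> 1\<close>, each \<open>s n ^ i\<close> with
    \<open>i < d\<close> is at least \<open>s n ^ d\<close>. The normalization then gives
    \<open>s n ^ d \<le> 1 / M (r n)\<close>, which the choice of \<open>r\<close> makes
    small.\<close>
  have s_d: "(\<lambda>n. s n ^ d) \<longlonglongrightarrow> 0"
  proof (rule LIMSEQ_norm_0)
    fix n
    have "s n ^ d * M (r n) \<le> (\<Sum>j\<in>UNIV. \<Sum>i\<in>{1..<d}. norm (a n j i) * s n ^ i)"
      unfolding M_def a_def[symmetric] sum_distrib_left
    proof (intro sum_mono)
      fix j i assume "i \<in> {1..<d}"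
      then have "s n ^ d \<le> s n ^ i"
        using s by (intro power_decreasing) auto
      then show "s n ^ d * norm (a n j i) \<le> norm (a n j i) * s n ^ i"
        by (metis mult.commute mult_left_mono norm_ge_zero)
    qed
    then have "s n ^ d * M (r n) \<le> 1"
      using s(3) by simp
    then have "s n ^ d \<le> 1 / M (r n)"
      using M_r[of n] by (simp add: field_simps)
    also have "\<dots> < 1 / real (Suc n)"
      using M_r[of n] by (intro divide_strict_left_mono) auto
    finally show "norm (s n ^ d) < 1 / real (Suc n)"
      using s(1) by simp
  qed
  define b where "b n = (\<lambda>(j, i). a n j i * of_real (s n) ^ i)" for n
  have norm_b: "norm (b n (j, i)) = norm (a n j i) * s n ^ i" for n j i
    using s(1) by (simp add: b_def norm_mult norm_power)
  have b_sum: "(\<Sum>p\<in>UNIV \<times> {1..<d}. norm (b n p)) = 1" for n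
    using s(3)[of n] by (simp add: sum.cartesian_product flip: norm_b)
  have norm_b_le: "norm (b n p) \<le> 1" if "p \<in> UNIV \<times> {1..<d}" for n p
    using member_le_sum[of p "UNIV \<times> {1..<d}" "\<lambda>p. norm (b n p)"] that b_sum by simp

  \<comment> \<open>The limit curve\<close>
  have "countable (UNIV \<times> {1..<d} :: ('m \<times> nat) set)"
    by simp
  from function_convergent_subsequence[OF this, of b 1] norm_b_le obtain k where
    k: "strict_mono (k :: nat \<Rightarrow> nat)"
      and lim: "\<And>p. p \<in> UNIV \<times> {1..<d} \<Longrightarrow> \<exists>l. (\<lambda>n. b (k n) p) \<longlonglongrightarrow> l"
    by blast
  define L where "L p = lim (\<lambda>n. b (k n) p)" for p
  have L: "(\<lambda>n. b (k n) p) \<longlonglongrightarrow> L p" if "p \<in> UNIV \<times> {1..<d}" for p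
    using lim[OF that] unfolding L_def by (simp add: convergent_def flip: convergent_LIMSEQ_iff)
  \<comment> \<open>The constant term is the limit \<open>y\<close> of the values along
    \<open>x\<close>. There is no term of degree \<open>d\<close>, since rescaling makes it tend to
    zero.\<close>
  define l :: "complex poly ^ 'm" where
    "l = (\<chi> j. [:y $ j:] + (\<Sum>i\<in>{1..<d}. monom (L (j, i)) i))"
  have coeff_l: "coeff (l $ j) i = L (j, i)" if "i \<in> {1..<d}" for i j
    using that by (auto simp: l_def coeff_sum coeff_pCons split: nat.split)
  \<comment> \<open>The normalization survives in the limit, so some limit coefficient is nonzero.
    All of them belong to positive powers, which makes the curve non-constant.\<close>
  have "(\<lambda>n. \<Sum>p\<in>UNIV \<times> {1..<d}. norm (b (k n) p)) \<longlonglongrightarrow> (\<Sum>p\<in>UNIV \<times> {1..<d}. norm (L p))"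
    by (intro tendsto_intros L)
  then have "(\<Sum>p\<in>UNIV \<times> {1..<d}. norm (L p)) = 1"
    unfolding b_sum by (simp only: LIMSEQ_const_iff)
  then have "\<exists>p\<in>UNIV \<times> {1..<d}. L p \<noteq> 0"
    by (metis norm_zero sum.neutral zero_neq_one)
  then obtain j0 i0 where ji: "i0 \<in> {1..<d}" "L (j0, i0) \<noteq> 0"
    by auto
  have nonconst: "\<not> curve_eval l constant_on UNIV"
  proof
    assume "curve_eval l constant_on UNIV"
    then obtain z where "\<And>t. curve_eval l t = z"
      unfolding constant_on_def by blast
    then have "poly (l $ j0) t = poly [:z $ j0:] t" for t
      by (simp add: curve_eval_def vec_eq_iff)
    then have "l $ j0 = [:z $ j0:]"
      by (intro poly_ext)
    then show False
      using ji coeff_l[of i0 j0] by (auto simp: coeff_pCons split: nat.splits)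
  qed
  have "degree (l $ j) \<le> d - 1" for j
    unfolding l_def by (auto intro!: degree_add_le degree_sum_le order_trans[OF degree_monom_le])
  then have degree: "curve_degree l \<le> d - 1"
    unfolding curve_degree_def by (intro Max.boundedI) auto

  \<comment> \<open>Points of the curve as limits along sequences tending to infinity\<close>
  have rk: "filterlim (\<lambda>n. r (k n)) at_top sequentially"
    using r_top filterlim_subseq[OF k] by (rule filterlim_compose)
  have curve: "curve_eval l t \<in> nonproper_set ?f" for t
  proof -
    define p where "p n = x (r (k n)) + (t * of_real (s (k n))) *s v (r (k n))" for n
    obtain V where V: "\<And>n. norm (v n) \<le> V"
      using v unfolding bounded_iff by auto
    \<comment> \<open>With scales at most \<open>1\<close> and directions bounded by
      \<open>V\<close>, the base point is moved by at most \<open>norm t * V\<close>, so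
      \<open>p\<close> tends to infinity with \<open>x\<close>.\<close>
    have "norm (x (r (k n))) + (- (norm t * V)) \<le> norm (p n)" for n
    proof -
      have "norm ((t * of_real (s (k n))) *s v (r (k n))) = norm t * (s (k n) * norm (v (r (k n))))"
        using s(1) by (simp add: norm_vector_scalar_mult norm_mult)
      also have "\<dots> \<le> norm t * (1 * V)"
        using s V by (intro mult_left_mono mult_mono) (auto intro: order_trans[OF norm_ge_zero])
      finally show ?thesis
        unfolding p_def using norm_diff_ineq[of "x (r (k n))" "(t * of_real (s (k n))) *s v (r (k n))"] by simp
    qed
    moreover have "filterlim (\<lambda>n. norm (x (r (k n))) + (- (norm t * V))) at_top sequentially"
      using filterlim_tendsto_add_at_top[OF tendsto_const filterlim_compose[OF x rk], of "- (norm t * V)"]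
      by (simp add: add.commute)
    ultimately have "filterlim (\<lambda>n. norm (p n)) at_top sequentially"
      by (auto intro: filterlim_at_top_mono)
    moreover have "(\<lambda>n. ?f (p n)) \<longlonglongrightarrow> curve_eval l t"
    proof (rule vec_tendstoI)
      fix j
      \<comment> \<open>The restriction to the line splits into the value at the base point, the
        rescaled inner terms, and the top term, whose coefficient depends on the direction
        only.\<close>
      have *: "?f (p n) $ j = ?f (x (r (k n))) $ j + (\<Sum>i\<in>{1..<d}. b (k n) (j, i) * t ^ i)
          + c j (v (r (k n))) * (of_real (s (k n) ^ d) * t ^ d)" for n
      proof -
        let ?s = "of_real (s (k n)) :: complex"
        have "?f (p n) $ j = poly (q j (x (r (k n))) (v (r (k n)))) (t * ?s)"
          by (simp add: q p_def)
        also have "\<dots> = (\<Sum>i\<le>d. a (k n) j i * (t * ?s) ^ i)"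
          unfolding a_def by (rule poly_eq_sum_atMost[OF deg])
        also have "{..d} = insert 0 (insert d {1..<d})"
          using \<open>d \<ge> 1\<close> by auto
        also have "(\<Sum>i\<in>insert 0 (insert d {1..<d}). a (k n) j i * (t * ?s) ^ i)
            = a (k n) j 0 + (a (k n) j d * (t * ?s) ^ d + (\<Sum>i\<in>{1..<d}. a (k n) j i * (t * ?s) ^ i))"
          using \<open>d \<ge> 1\<close> by simp
        also have "a (k n) j 0 = ?f (x (r (k n))) $ j"
          using q[of j "x (r (k n))" "v (r (k n))" 0] by (simp add: poly_0_coeff_0 a_def)
        finally show ?thesis
          by (simp add: a_def b_def c power_mult_distrib mult_ac)
      qed
      have "(\<lambda>n. ?f (x (r (k n))) $ j) \<longlonglongrightarrow> y $ j"
        by (intro tendsto_vec_nth filterlim_compose[OF fx rk])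
      moreover have "(\<lambda>n. \<Sum>i\<in>{1..<d}. b (k n) (j, i) * t ^ i) \<longlonglongrightarrow> (\<Sum>i\<in>{1..<d}. L (j, i) * t ^ i)"
        by (intro tendsto_intros L) auto
      moreover have "(\<lambda>n. c j (v (r (k n))) * (of_real (s (k n) ^ d) * t ^ d)) \<longlonglongrightarrow> 0"
      proof -
        have "(\<lambda>n. s (k n) ^ d) \<longlonglongrightarrow> 0"
          using LIMSEQ_subseq_LIMSEQ[OF s_d k] by (simp add: o_def)
        then have "(\<lambda>n. of_real (s (k n) ^ d) * t ^ d) \<longlonglongrightarrow> of_real 0 * t ^ d"
          by (intro tendsto_intros)
        then have 1: "(\<lambda>n. of_real (s (k n) ^ d) * t ^ d) \<longlonglongrightarrow> 0"
          by simp
        \<comment> \<open>The top coefficient is continuous in the direction and so stays bounded;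
          its product with a null sequence tends to zero.\<close>
        have "bounded (range (\<lambda>n. c j (v n)))"
          using c(2) v by (rule bounded_range_continuous)
        then have "Bseq (\<lambda>n. c j (v (r (k n))))"
          unfolding Bseq_eq_bounded by (rule bounded_subset) auto
        then show ?thesis
          using bounded_bilinear.Bfun_prod_Zfun[OF bounded_bilinear_mult] 1 by (simp add: tendsto_Zfun_iff)
      qed
      ultimately have "(\<lambda>n. ?f (p n) $ j) \<longlonglongrightarrow> y $ j + (\<Sum>i\<in>{1..<d}. L (j, i) * t ^ i) + 0"
        unfolding * by (intro tendsto_add)
      then show "(\<lambda>n. ?f (p n) $ j) \<longlonglongrightarrow> curve_eval l t $ j"
        by (simp add: curve_eval_def l_def poly_sum poly_monom)
    qed
    ultimately show ?thesis
      unfolding nonproper by blast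
  qed
  have "curve_eval l 0 = y"
    by (simp add: curve_eval_def l_def poly_sum poly_monom vec_eq_iff power_0_left)
  then have "y \<in> range (curve_eval l)"
    by (metis rangeI)
  with nonconst degree curve show "\<exists>l :: complex poly ^ 'm.
      \<not> curve_eval l constant_on UNIV \<and>
      curve_degree l \<le> d - 1 \<and>
      range (curve_eval l) \<subseteq> nonproper_set (polymap_eval F) \<and>
      y \<in> range (curve_eval l)"
    by blast
qed

end
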